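(* Let $(h,U,u_e,J)$ be a solution to $$\partial_t u_e+u_e\,\partial_x u_e=-\partial_x p,\qquad \partial_t h+\partial_x(hU)=0,\qquad \partial_t(hU)+\partial_x J=-h\,\partial_x p-\bar\delta\,\bar\tau_b .$$ Assume $\delta_1$ is defined by $hU=(h-\bar\delta\delta_1)u_e$. Then $\delta_1$ and $\delta_2$ solve the von Kármán equation $$\partial_t(u_e\delta_1)+u_e\delta_1\,\partial_x u_e+\partial_x(u_e^2\delta_2)=\bar\tau_b$$ if and only if there holds $$J=\big(h-\bar\delta(\delta_1+\delta_2)\big)u_e^2 .$$
   Context: All unknowns are functions of time $t$ and of the horizontal variable $x$. Here $h$ is the water depth, $U$ the depth-averaged horizontal velocity, $u_e$ the velocity of an ideal fluid (constant along the vertical), $p$ the hydrostatic pressure, whose horizontal gradient $\partial_x p$ does not depend on the vertical variable, $J$ the momentum flux for which a closure is sought, $\bar\tau_b$ the (rescaled) bottom shear stress, and $\bar\delta>0$ a small parameter related to the thickness of the viscous layer at the bottom. The functions $\delta_1$ and $\delta_2$ are the displacement thickness and the momentum thickness of the viscous layer. The three equations in the claim are, in order, the ideal fluid equation, the depth-integrated mass conservation, and the depth-integrated momentum balance with a generic flux $J$.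
   Formalization: "Only if" fails literally, as J enters only via ∂_x J (h=1, J=1, all else 0). Proved for classical solutions: "if" as stated; von Kármán iff J is the formula plus a function of t; and the exact equivalence if, at each t, J and the formula agree at some x or come arbitrarily close. *)

theory Defs
  imports "HOL-Analysis.Analysis"
begin

text \<open>
  Fields are functions of time and of the horizontal variable, considered on a product
  of a time interval and a space interval. Intervals may be closed, half-open or unbounded;
  partial derivatives are taken within them, hence are one-sided at endpoints.
\<close>

definition nondegenerate_interval :: "real set \<Rightarrow> bool" where
  "nondegenerate_interval S \<longleftrightarrow> is_interval S \<and> interior S \<noteq> {}"

definition differentiable_t :: "real set \<Rightarrow> (real \<Rightarrow> real \<Rightarrow> real) \<Rightarrow> real \<Rightarrow> real \<Rightarrow> bool" where
  "differentiable_t T f t x \<longleftrightarrow> (\<lambda>s. f s x) differentiable (at t within T)"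

definition differentiable_x :: "real set \<Rightarrow> (real \<Rightarrow> real \<Rightarrow> real) \<Rightarrow> real \<Rightarrow> real \<Rightarrow> bool" where
  "differentiable_x X f t x \<longleftrightarrow> (\<lambda>y. f t y) differentiable (at x within X)"

definition partial_t :: "real set \<Rightarrow> (real \<Rightarrow> real \<Rightarrow> real) \<Rightarrow> real \<Rightarrow> real \<Rightarrow> real" where
  "partial_t T f t x = vector_derivative (\<lambda>s. f s x) (at t within T)"

definition partial_x :: "real set \<Rightarrow> (real \<Rightarrow> real \<Rightarrow> real) \<Rightarrow> real \<Rightarrow> real \<Rightarrow> real" where
  "partial_x X f t x = vector_derivative (\<lambda>y. f t y) (at x within X)"

text \<open>
  The pressure \<open>p t x z\<close> also depends on the vertical variable \<open>z\<close>, which ranges over the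
  (nonempty) column \<open>Z t x\<close>; its horizontal gradient is a function \<open>px\<close> of time and of the
  horizontal variable only.
\<close>

definition horizontal_pressure_gradient ::
  "real set \<Rightarrow> real set \<Rightarrow> (real \<Rightarrow> real \<Rightarrow> real set) \<Rightarrow> (real \<Rightarrow> real \<Rightarrow> real \<Rightarrow> real)
    \<Rightarrow> (real \<Rightarrow> real \<Rightarrow> real) \<Rightarrow> bool" where
  "horizontal_pressure_gradient T X Z p px \<longleftrightarrow>
     (\<forall>t\<in>T. \<forall>x\<in>X. Z t x \<noteq> {} \<and>
        (\<forall>z\<in>Z t x. ((\<lambda>y. p t y z) has_real_derivative px t x) (at x within X)))"

text \<open>
  Solutions are classical: the only regularity required is the existence of the partial
  derivatives occurring in the equations. Products such as \<open>hU\<close> are differentiated as a whole.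
\<close>

definition ideal_fluid_eq ::
  "real set \<Rightarrow> real set \<Rightarrow> (real \<Rightarrow> real \<Rightarrow> real) \<Rightarrow> (real \<Rightarrow> real \<Rightarrow> real) \<Rightarrow> bool" where
  "ideal_fluid_eq T X ue px \<longleftrightarrow>
     (\<forall>t\<in>T. \<forall>x\<in>X. differentiable_t T ue t x \<and> differentiable_x X ue t x \<and>
        partial_t T ue t x + ue t x * partial_x X ue t x = - px t x)"

definition mass_eq ::
  "real set \<Rightarrow> real set \<Rightarrow> (real \<Rightarrow> real \<Rightarrow> real) \<Rightarrow> (real \<Rightarrow> real \<Rightarrow> real) \<Rightarrow> bool" where
  "mass_eq T X h U \<longleftrightarrow>
     (\<forall>t\<in>T. \<forall>x\<in>X. differentiable_t T h t x \<and>
        differentiable_x X (\<lambda>t x. h t x * U t x) t x \<and>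
        partial_t T h t x + partial_x X (\<lambda>t x. h t x * U t x) t x = 0)"

definition momentum_eq ::
  "real set \<Rightarrow> real set \<Rightarrow> (real \<Rightarrow> real \<Rightarrow> real) \<Rightarrow> (real \<Rightarrow> real \<Rightarrow> real)
    \<Rightarrow> (real \<Rightarrow> real \<Rightarrow> real) \<Rightarrow> (real \<Rightarrow> real \<Rightarrow> real) \<Rightarrow> real \<Rightarrow> (real \<Rightarrow> real \<Rightarrow> real) \<Rightarrow> bool" where
  "momentum_eq T X h U J px \<delta> \<tau> \<longleftrightarrow>
     (\<forall>t\<in>T. \<forall>x\<in>X. differentiable_t T (\<lambda>t x. h t x * U t x) t x \<and> differentiable_x X J t x \<and>
        partial_t T (\<lambda>t x. h t x * U t x) t x + partial_x X J t x
          = - h t x * px t x - \<delta> * \<tau> t x)"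

definition von_karman_eq ::
  "real set \<Rightarrow> real set \<Rightarrow> (real \<Rightarrow> real \<Rightarrow> real) \<Rightarrow> (real \<Rightarrow> real \<Rightarrow> real)
    \<Rightarrow> (real \<Rightarrow> real \<Rightarrow> real) \<Rightarrow> (real \<Rightarrow> real \<Rightarrow> real) \<Rightarrow> bool" where
  "von_karman_eq T X ue \<delta>1 \<delta>2 \<tau> \<longleftrightarrow>
     (\<forall>t\<in>T. \<forall>x\<in>X. differentiable_t T (\<lambda>t x. ue t x * \<delta>1 t x) t x \<and>
        differentiable_x X ue t x \<and>
        differentiable_x X (\<lambda>t x. (ue t x)\<^sup>2 * \<delta>2 t x) t x \<and>
        partial_t T (\<lambda>t x. ue t x * \<delta>1 t x) t x + ue t x * \<delta>1 t x * partial_x X ue t x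
          + partial_x X (\<lambda>t x. (ue t x)\<^sup>2 * \<delta>2 t x) t x = \<tau> t x)"

definition closure_flux ::
  "real \<Rightarrow> (real \<Rightarrow> real \<Rightarrow> real) \<Rightarrow> (real \<Rightarrow> real \<Rightarrow> real) \<Rightarrow> (real \<Rightarrow> real \<Rightarrow> real)
    \<Rightarrow> (real \<Rightarrow> real \<Rightarrow> real) \<Rightarrow> real \<Rightarrow> real \<Rightarrow> real" where
  "closure_flux \<delta> h ue \<delta>1 \<delta>2 t x = (h t x - \<delta> * (\<delta>1 t x + \<delta>2 t x)) * (ue t x)\<^sup>2"

text \<open>
  A flux enters the momentum equation only through its \<open>x\<close>-derivative, so the equations cannot
  distinguish fluxes that differ by a function of time. The following condition fixes this
  freedom: at each time, two fluxes \<open>J\<close> and \<open>F\<close> are not bounded away from each other along \<open>X\<close>.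
  It holds when they agree at one point (say, an inflow boundary), or when
  their difference tends to zero at an end of \<open>X\<close> (a far-field condition).
\<close>

definition same_flux_normalization ::
  "real set \<Rightarrow> real set \<Rightarrow> (real \<Rightarrow> real \<Rightarrow> real) \<Rightarrow> (real \<Rightarrow> real \<Rightarrow> real) \<Rightarrow> bool" where
  "same_flux_normalization T X J F \<longleftrightarrow>
     (\<forall>t\<in>T. \<forall>\<epsilon>>0. \<exists>x\<in>X. \<bar>J t x - F t x\<bar> < \<epsilon>)"

end

theory Submission
  imports Defs
begin

text \<open>
  Multiplying the von Karman equation by \<open>\<delta>\<close> and eliminating \<open>\<delta> u\<^sub>e \<delta>\<^sub>1 = h u\<^sub>e - h U\<close> together with
  all time derivatives turns it into \<open>\<partial>\<^sub>x (J - h U u\<^sub>e + \<delta> u\<^sub>e\<^sup>2 \<delta>\<^sub>2) = 0\<close>. As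
  \<open>h U u\<^sub>e - \<delta> u\<^sub>e\<^sup>2 \<delta>\<^sub>2\<close> is the closure flux, the equation says exactly that \<open>J\<close> and the
  closure flux differ by a function of time.
\<close>

text \<open>A connected set with more than one point has no isolated points, and nonempty interior
  rules out singletons. Derivatives within \<open>S\<close> are therefore unique, even at
  endpoints.\<close>

lemma nondegenerate_interval_at_within_nontrivial:
  assumes "nondegenerate_interval S" "x \<in> S"
  shows "at x within S \<noteq> bot"
proof -
  have "connected S" "interior S \<noteq> {}"
    using assms by (auto simp: nondegenerate_interval_def is_interval_connected)
  moreover have "S \<noteq> {y}" for y
    using \<open>interior S \<noteq> {}\<close> by auto
  ultimately show ?thesis
    using connected_imp_perfect[of S x] assms(2) by (simp add: trivial_limit_within)
qed

lemma has_field_derivative_transform_on: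
  assumes "(f has_field_derivative D) (at x within S)" "x \<in> S" "\<And>y. y \<in> S \<Longrightarrow> f y = g y"
  shows "(g has_field_derivative D) (at x within S)"
  by (rule has_field_derivative_transform_within[OF assms(1) zero_less_one]) (use assms in auto)

text \<open>Uniqueness of the limit within \<open>S\<close> makes the two forms interchangeable: the
  definitions speak of differentiability and \<open>vector_derivative\<close>, the calculus rules of
  \<open>has_real_derivative\<close>.\<close>

lemma has_real_derivative_iff_vector_derivative:
  assumes "nondegenerate_interval S" "x \<in> S"
  shows "(f has_real_derivative D) (at x within S) \<longleftrightarrow>
         f differentiable (at x within S) \<and> vector_derivative f (at x within S) = D"
  unfolding has_real_derivative_iff_has_vector_derivative
  using vector_derivative_within[OF nondegenerate_interval_at_within_nontrivial[OF assms]]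
    differentiableI_vector vector_derivative_works by metis

lemma closure_flux_eq:
  assumes "w = (h t x - \<delta> * \<delta>1 t x) * ue t x"
  shows "closure_flux \<delta> h ue \<delta>1 \<delta>2 t x = w * ue t x - \<delta> * ((ue t x)\<^sup>2 * \<delta>2 t x)"
  unfolding closure_flux_def assms by (simp add: algebra_simps power2_eq_square)

text \<open>The equivalence already holds at each point \<open>(t, x)\<close> separately. No
  regularity of \<open>\<delta>1\<close> or \<open>\<delta>2\<close> is assumed, so the
  differentiability clauses must be matched along with the equation.\<close>

lemma von_karman_eq_iff_flux_difference:
  assumes T: "nondegenerate_interval T" and X: "nondegenerate_interval X"
    and pos: "\<delta> > 0"
    and ideal: "ideal_fluid_eq T X ue px"
    and mass: "mass_eq T X h U"
    and momentum: "momentum_eq T X h U J px \<delta> \<tau>"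
    and thickness: "\<forall>t\<in>T. \<forall>x\<in>X. h t x * U t x = (h t x - \<delta> * \<delta>1 t x) * ue t x"
  shows "von_karman_eq T X ue \<delta>1 \<delta>2 \<tau> \<longleftrightarrow>
    (\<forall>t\<in>T. \<forall>x\<in>X.
      ((\<lambda>y. J t y - closure_flux \<delta> h ue \<delta>1 \<delta>2 t y) has_real_derivative 0) (at x within X))"
  unfolding von_karman_eq_def
proof (intro ball_cong refl)
  fix t x assume t: "t \<in> T" and x: "x \<in> X"
  note derivT = has_real_derivative_iff_vector_derivative[OF T t]
    and derivX = has_real_derivative_iff_vector_derivative[OF X x]
  define ht where "ht = partial_t T h t x"
  define et where "et = partial_t T ue t x"
  define ex where "ex = partial_x X ue t x"
  define wt where "wt = partial_t T (\<lambda>t x. h t x * U t x) t x"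
  define wx where "wx = partial_x X (\<lambda>t x. h t x * U t x) t x"
  define Jx where "Jx = partial_x X J t x"
  have ht: "((\<lambda>s. h s x) has_real_derivative ht) (at t within T)"
    and et: "((\<lambda>s. ue s x) has_real_derivative et) (at t within T)"
    and ex: "((\<lambda>y. ue t y) has_real_derivative ex) (at x within X)"
    and wt: "((\<lambda>s. h s x * U s x) has_real_derivative wt) (at t within T)"
    and wx: "((\<lambda>y. h t y * U t y) has_real_derivative wx) (at x within X)"
    and Jx: "((\<lambda>y. J t y) has_real_derivative Jx) (at x within X)"
    using ideal mass momentum t x
    by (auto simp: derivT derivX ideal_fluid_eq_def mass_eq_def momentum_eq_def
        differentiable_t_def differentiable_x_def partial_t_def partial_x_def
        ht_def et_def ex_def wt_def wx_def Jx_def)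
  have eqs: "et + ue t x * ex = - px t x" "ht + wx = 0"
    "wt + Jx = - h t x * px t x - \<delta> * \<tau> t x"
    using ideal mass momentum t x
    by (simp_all add: ideal_fluid_eq_def mass_eq_def momentum_eq_def
        ht_def et_def ex_def wt_def wx_def Jx_def)

  \<comment> \<open>The value comes from solving the thickness relation for
    \<open>ue * \<delta>1\<close> and differentiating in time; this also proves that the product is
    differentiable.\<close>
  define dt where "dt = (ht * ue t x + h t x * et - wt) / \<delta>"
  have "((\<lambda>s. (h s x * ue s x - h s x * U s x) / \<delta>) has_real_derivative dt) (at t within T)"
    unfolding dt_def
    using DERIV_cdivide[OF DERIV_diff[OF DERIV_mult[OF ht et] wt], of \<delta>] by (simp add: mult.commute)
  moreover have "(h s x * ue s x - h s x * U s x) / \<delta> = ue s x * \<delta>1 s x" if "s \<in> T" for s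
  proof -
    have "h s x * U s x = (h s x - \<delta> * \<delta>1 s x) * ue s x"
      using thickness that x by blast
    then have "h s x * ue s x - h s x * U s x = (ue s x * \<delta>1 s x) * \<delta>"
      by algebra
    then show ?thesis
      using pos by simp
  qed
  ultimately have dt: "((\<lambda>s. ue s x * \<delta>1 s x) has_real_derivative dt) (at t within T)"
    by (rule has_field_derivative_transform_on[OF _ t])
  have dt': "differentiable_t T (\<lambda>t x. ue t x * \<delta>1 t x) t x"
    "partial_t T (\<lambda>t x. ue t x * \<delta>1 t x) t x = dt"
    using dt by (simp_all add: derivT differentiable_t_def partial_t_def)
  have ex': "differentiable_x X ue t x"
    using ex by (simp add: derivX differentiable_x_def)

  define m where "m = (\<lambda>y. (ue t y)\<^sup>2 * \<delta>2 t y)"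
  define F where "F = (\<lambda>y. closure_flux \<delta> h ue \<delta>1 \<delta>2 t y)"
  \<comment> \<open>\<open>q\<close> is the \<open>x\<close>-derivative of
    \<open>h * U * ue - J\<close>; on \<open>X\<close> this function equals
    \<open>\<delta> * m - (J - F)\<close>.\<close>
  define q where "q = wx * ue t x + h t x * U t x * ex - Jx"
  have F_eq: "F y = h t y * U t y * ue t y - \<delta> * m y" if "y \<in> X" for y
    using thickness t that unfolding F_def m_def by (intro closure_flux_eq) auto
  have q: "((\<lambda>y. h t y * U t y * ue t y - J t y) has_real_derivative q) (at x within X)"
    unfolding q_def using DERIV_diff[OF DERIV_mult[OF wx ex] Jx] by (simp add: mult.commute)
  \<comment> \<open>Each of \<open>m\<close> and \<open>J - F\<close> is recovered from the other
    and a function with derivative \<open>q\<close>, so existence of the derivative transfers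
    together with its value.\<close>
  have flux: "((\<lambda>y. J t y - F y) has_real_derivative 0) (at x within X) \<longleftrightarrow>
    (m has_real_derivative q / \<delta>) (at x within X)" (is "?L \<longleftrightarrow> ?R")
  proof
    assume ?L
    then have "((\<lambda>y. ((h t y * U t y * ue t y - J t y) + (J t y - F y)) / \<delta>)
        has_real_derivative q / \<delta>) (at x within X)"
      using DERIV_cdivide[OF DERIV_add[OF q]] by fastforce
    then show ?R
      by (rule has_field_derivative_transform_on[OF _ x]) (use F_eq pos in auto)
  next
    assume ?R
    then have "((\<lambda>y. \<delta> * m y - (h t y * U t y * ue t y - J t y))
        has_real_derivative 0) (at x within X)"
      using DERIV_diff[OF DERIV_cmult[of m "q / \<delta>" x X \<delta>] q] pos by simp
    then show ?L
      by (rule has_field_derivative_transform_on[OF _ x]) (use F_eq in auto)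
  qed

  \<comment> \<open>Mass, ideal fluid and momentum equations replace \<open>ht\<close>,
    \<open>et\<close> and \<open>wt\<close>. The pressure terms and the shear stress cancel, as do
    the terms \<open>h * ue * ex\<close>.\<close>
  have "\<delta> * (dt + ue t x * \<delta>1 t x * ex - \<tau> t x) = - q"
  proof -
    have dt_eq: "\<delta> * dt = ht * ue t x + h t x * et - wt"
      using pos by (simp add: dt_def)
    have \<delta>1_eq: "\<delta> * (ue t x * \<delta>1 t x) = h t x * ue t x - h t x * U t x"
      using thickness[rule_format, OF t x] by algebra
    have eqs': "ht = - wx" "et = - px t x - ue t x * ex"
      "wt = - h t x * px t x - \<delta> * \<tau> t x - Jx"
      using eqs by simp_all
    have "\<delta> * (dt + ue t x * \<delta>1 t x * ex - \<tau> t x) =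
        \<delta> * dt + \<delta> * (ue t x * \<delta>1 t x) * ex - \<delta> * \<tau> t x"
      by (simp add: algebra_simps)
    also have "\<dots> = - q"
      unfolding dt_eq \<delta>1_eq eqs' q_def by (simp add: algebra_simps)
    finally show ?thesis .
  qed
  then have "dt + ue t x * \<delta>1 t x * ex - \<tau> t x = - (q / \<delta>)"
    using pos by (simp add: field_simps)
  \<comment> \<open>Here \<open>mx\<close> is arbitrary, since \<open>m\<close> is not yet known to
    be differentiable.\<close>
  then have balance: "dt + ue t x * \<delta>1 t x * ex + mx = \<tau> t x \<longleftrightarrow> mx = q / \<delta>" for mx
    by auto
  show "(differentiable_t T (\<lambda>t x. ue t x * \<delta>1 t x) t x \<and>
        differentiable_x X ue t x \<and>
        differentiable_x X (\<lambda>t x. (ue t x)\<^sup>2 * \<delta>2 t x) t x \<and>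
        partial_t T (\<lambda>t x. ue t x * \<delta>1 t x) t x + ue t x * \<delta>1 t x * partial_x X ue t x
          + partial_x X (\<lambda>t x. (ue t x)\<^sup>2 * \<delta>2 t x) t x = \<tau> t x) \<longleftrightarrow>
    ((\<lambda>y. J t y - closure_flux \<delta> h ue \<delta>1 \<delta>2 t y) has_real_derivative 0) (at x within X)"
    using dt' ex' flux balance
    by (simp add: derivX m_def F_def ex_def differentiable_x_def partial_x_def)
qed

text \<open>Adding a function of time to \<open>J\<close> preserves the momentum equation, so the
  converse recovers the closure up to such a function, and exactly once the normalization removes
  it.\<close>

theorem proposition3p1:
  fixes T X :: "real set"
    and Z :: "real \<Rightarrow> real \<Rightarrow> real set"
    and p :: "real \<Rightarrow> real \<Rightarrow> real \<Rightarrow> real"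
    and px h U ue J \<tau> \<delta>1 \<delta>2 :: "real \<Rightarrow> real \<Rightarrow> real"
    and \<delta> :: real
  assumes "nondegenerate_interval T" and "nondegenerate_interval X"
    and "\<delta> > 0"
    and "horizontal_pressure_gradient T X Z p px"
    and "ideal_fluid_eq T X ue px"
    and "mass_eq T X h U"
    and "momentum_eq T X h U J px \<delta> \<tau>"
    and "\<forall>t\<in>T. \<forall>x\<in>X. h t x * U t x = (h t x - \<delta> * \<delta>1 t x) * ue t x"
  shows "((\<forall>t\<in>T. \<forall>x\<in>X. J t x = closure_flux \<delta> h ue \<delta>1 \<delta>2 t x)
            \<longrightarrow> von_karman_eq T X ue \<delta>1 \<delta>2 \<tau>)
       \<and> (von_karman_eq T X ue \<delta>1 \<delta>2 \<tau> \<longleftrightarrow>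
            (\<exists>c. \<forall>t\<in>T. \<forall>x\<in>X. J t x = closure_flux \<delta> h ue \<delta>1 \<delta>2 t x + c t))
       \<and> (same_flux_normalization T X J (closure_flux \<delta> h ue \<delta>1 \<delta>2) \<longrightarrow>
            (von_karman_eq T X ue \<delta>1 \<delta>2 \<tau> \<longleftrightarrow>
              (\<forall>t\<in>T. \<forall>x\<in>X. J t x = closure_flux \<delta> h ue \<delta>1 \<delta>2 t x)))"
proof -
  define F where "F = closure_flux \<delta> h ue \<delta>1 \<delta>2"
  have conv: "convex X"
    using assms(2) is_interval_convex unfolding nondegenerate_interval_def by blast
  \<comment> \<open>At a fixed time, a function with zero derivative on the convex set
    \<open>X\<close> is constant.\<close>
  have const: "(\<forall>x\<in>X. ((\<lambda>y. J t y - F t y) has_real_derivative 0) (at x within X)) \<longleftrightarrow>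
      (\<exists>c. \<forall>x\<in>X. J t x = F t x + c)" for t
  proof
    assume "\<forall>x\<in>X. ((\<lambda>y. J t y - F t y) has_real_derivative 0) (at x within X)"
    then obtain c where "\<forall>x\<in>X. J t x - F t x = c"
      using has_field_derivative_zero_constant[OF conv, of "\<lambda>y. J t y - F t y"] by auto
    then show "\<exists>c. \<forall>x\<in>X. J t x = F t x + c"
      by (intro exI[of _ c]) (auto simp: algebra_simps)
  next
    assume "\<exists>c. \<forall>x\<in>X. J t x = F t x + c"
    then obtain c where "\<forall>x\<in>X. J t x = F t x + c" ..
    then show "\<forall>x\<in>X. ((\<lambda>y. J t y - F t y) has_real_derivative 0) (at x within X)"
      by (intro ballI has_field_derivative_transform_on[OF DERIV_const[of c]]) simp_all
  qed
  have "von_karman_eq T X ue \<delta>1 \<delta>2 \<tau> \<longleftrightarrow> (\<forall>t\<in>T. \<exists>c. \<forall>x\<in>X. J t x = F t x + c)"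
    using von_karman_eq_iff_flux_difference[OF assms(1-3,5-8), of \<delta>2] const
    unfolding F_def by simp
  \<comment> \<open>The constants are chosen independently at each time; nothing is claimed about
    the regularity of \<open>c\<close>.\<close>
  also have "\<dots> \<longleftrightarrow> (\<exists>c. \<forall>t\<in>T. \<forall>x\<in>X. J t x = F t x + c t)"
    by (rule bchoice_iff)
  finally have vk: "von_karman_eq T X ue \<delta>1 \<delta>2 \<tau> \<longleftrightarrow>
      (\<exists>c. \<forall>t\<in>T. \<forall>x\<in>X. J t x = F t x + c t)" .
  have exact: "von_karman_eq T X ue \<delta>1 \<delta>2 \<tau>" if "\<forall>t\<in>T. \<forall>x\<in>X. J t x = F t x"
    unfolding vk using that by (intro exI[of _ "\<lambda>_. 0"]) auto
  have normalized: "\<forall>t\<in>T. \<forall>x\<in>X. J t x = F t x"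
    if norm: "same_flux_normalization T X J F" and sol: "von_karman_eq T X ue \<delta>1 \<delta>2 \<tau>"
  proof -
    obtain c where c: "\<forall>t\<in>T. \<forall>x\<in>X. J t x = F t x + c t"
      using sol vk by blast
    have "c t = 0" if "t \<in> T" for t
    proof (rule ccontr)
      assume "c t \<noteq> 0"
      \<comment> \<open>The difference \<open>J - F\<close> equals \<open>c t\<close> all along
        \<open>X\<close>, so the tolerance \<open>\<bar>c t\<bar>\<close> cannot be met.\<close>
      then obtain x where "x \<in> X" "\<bar>J t x - F t x\<bar> < \<bar>c t\<bar>"
        using norm \<open>t \<in> T\<close> unfolding same_flux_normalization_def by (meson zero_less_abs_iff)
      then show False
        using c \<open>t \<in> T\<close> by simp
    qed
    then show ?thesis
      using c by simp
  qed
  show ?thesis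
    using vk exact normalized unfolding F_def by blast
qed

end
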